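(* Let $(J,\bullet)$ be a unital Jordan algebra over $\mathbb K$. Equip the set $J^\times$ of invertible elements with its symmetric space structure $\mu(x,y)=\sigma_x(y)=U_x(y^{-1})$. Let $a\in J^\times$ and let $\tau=\tau_{-a^{-1}}:J\to J$, $x\mapsto x-a^{-1}$, be translation by $-a^{-1}$. Then the translated symmetric space $\tau(J^\times)$ is given by $$\tau(J^\times)=\{x\in J \mid B(x,-a)\in \mathrm{GL}(J)\},$$ with product map, for all $x,y\in\tau(J^\times)$, $$\tau\bigl(\mu(\tau^{-1}(x),\tau^{-1}(y))\bigr)=2x+U_xa+B(x,-a)\,\tilde\tau_a(-y).$$
   Context: $\mathbb K$ is a commutative ring in which $2$ and $3$ are invertible. A Jordan algebra is a $\mathbb K$-module $J$ with a bilinear commutative product $\bullet$ satisfying $x\bullet(x^2\bullet y)=x^2\bullet(x\bullet y)$; here it has a unit element. $L_x y=x\bullet y$, $U_x=2L_x^2-L_{x^2}$. An element $x$ is invertible if $U_x\in\mathrm{GL}(J)$ (the group of invertible $\mathbb K$-linear endomorphisms); then $x^{-1}:=U_x^{-1}x$. $J^\times$ is the set of invertible elements. With $\mu(x,y)=U_x(y^{-1})$ it is a reflection space, i.e. the maps $\sigma_x=\mu(x,\cdot)$ satisfy $\sigma_x(x)=x$, $\sigma_x^2=\mathrm{id}$, $\sigma_x\sigma_y\sigma_x=\sigma_{\sigma_x(y)}$. The Jordan triple product of $J$ is $T(x,y,z)=2\bigl((x\bullet y)\bullet z+x\bullet(y\bullet z)-y\bullet(x\bullet z)\bigr)$, so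 that $Q(x):=\tfrac12T(x,\cdot,x)=U_x$. Write $T(x,y):=T(x,y,\cdot)$. The Bergman operator is $B(x,y)=\mathrm{id}_J-T(x,y)+Q(x)Q(y)$, and if $B(x,y)$ is invertible, the quasi-inverse is $\tilde\tau_y(x)=x^y=B(x,y)^{-1}(x-Q(x)y)$. *)

theory Defs
  imports Complex_Main
begin

locale unital_jordan_algebra = module scale
  for scale :: "'k::comm_ring_1 \<Rightarrow> 'j::ab_group_add \<Rightarrow> 'j" +
  fixes jprod :: "'j \<Rightarrow> 'j \<Rightarrow> 'j"
    and e :: 'j
  assumes jprod_add_right: "jprod x (y + z) = jprod x y + jprod x z"
    and jprod_scale_right: "jprod x (scale c y) = scale c (jprod x y)"
    and jprod_commute: "jprod x y = jprod y x"
    and jordan_identity: "jprod x (jprod (jprod x x) y) = jprod (jprod x x) (jprod x y)"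
    and unit_left: "jprod e x = x"

definition module_GL :: "('k::comm_ring_1 \<Rightarrow> 'j::ab_group_add \<Rightarrow> 'j) \<Rightarrow> ('j \<Rightarrow> 'j) set"
  where "module_GL scale = {f. module_hom scale scale f \<and> bij f}"

definition L_op :: "('j \<Rightarrow> 'j \<Rightarrow> 'j) \<Rightarrow> 'j \<Rightarrow> 'j \<Rightarrow> 'j"
  where "L_op jprod x = (\<lambda>y. jprod x y)"

definition U_op ::
  "('k::comm_ring_1 \<Rightarrow> 'j::ab_group_add \<Rightarrow> 'j) \<Rightarrow> ('j \<Rightarrow> 'j \<Rightarrow> 'j) \<Rightarrow> 'j \<Rightarrow> 'j \<Rightarrow> 'j"
  where "U_op scale jprod x =
    (\<lambda>y. scale 2 (L_op jprod x (L_op jprod x y)) - L_op jprod (jprod x x) y)"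

definition J_units ::
  "('k::comm_ring_1 \<Rightarrow> 'j::ab_group_add \<Rightarrow> 'j) \<Rightarrow> ('j \<Rightarrow> 'j \<Rightarrow> 'j) \<Rightarrow> 'j set"
  where "J_units scale jprod = {x. U_op scale jprod x \<in> module_GL scale}"

text \<open>Meaningful only for elements of \<open>J_units scale jprod\<close>.\<close>

definition J_inverse ::
  "('k::comm_ring_1 \<Rightarrow> 'j::ab_group_add \<Rightarrow> 'j) \<Rightarrow> ('j \<Rightarrow> 'j \<Rightarrow> 'j) \<Rightarrow> 'j \<Rightarrow> 'j"
  where "J_inverse scale jprod x = inv (U_op scale jprod x) x"

definition J_mu ::
  "('k::comm_ring_1 \<Rightarrow> 'j::ab_group_add \<Rightarrow> 'j) \<Rightarrow> ('j \<Rightarrow> 'j \<Rightarrow> 'j) \<Rightarrow> 'j \<Rightarrow> 'j \<Rightarrow> 'j"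
  where "J_mu scale jprod x y = U_op scale jprod x (J_inverse scale jprod y)"

definition J_triple ::
  "('k::comm_ring_1 \<Rightarrow> 'j::ab_group_add \<Rightarrow> 'j) \<Rightarrow> ('j \<Rightarrow> 'j \<Rightarrow> 'j) \<Rightarrow> 'j \<Rightarrow> 'j \<Rightarrow> 'j \<Rightarrow> 'j"
  where "J_triple scale jprod x y z =
    scale 2 (jprod (jprod x y) z + jprod x (jprod y z) - jprod y (jprod x z))"

text \<open>The scalar \<open>1/2\<close>, in a commutative ring in which \<open>2\<close> is invertible.\<close>

definition ring_half :: "'k::comm_ring_1"
  where "ring_half = (THE h. 2 * h = 1)"

definition Q_op ::
  "('k::comm_ring_1 \<Rightarrow> 'j::ab_group_add \<Rightarrow> 'j) \<Rightarrow> ('j \<Rightarrow> 'j \<Rightarrow> 'j) \<Rightarrow> 'j \<Rightarrow> 'j \<Rightarrow> 'j"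
  where "Q_op scale jprod x = (\<lambda>y. scale ring_half (J_triple scale jprod x y x))"

definition bergman ::
  "('k::comm_ring_1 \<Rightarrow> 'j::ab_group_add \<Rightarrow> 'j) \<Rightarrow> ('j \<Rightarrow> 'j \<Rightarrow> 'j) \<Rightarrow> 'j \<Rightarrow> 'j \<Rightarrow> 'j \<Rightarrow> 'j"
  where "bergman scale jprod x y =
    (\<lambda>z. z - J_triple scale jprod x y z + Q_op scale jprod x (Q_op scale jprod y z))"

text \<open>\<open>quasi_inverse scale jprod y x\<close> is $x^y$; it is meaningful only if
  \<open>bergman scale jprod x y\<close> is invertible.\<close>

definition quasi_inverse ::
  "('k::comm_ring_1 \<Rightarrow> 'j::ab_group_add \<Rightarrow> 'j) \<Rightarrow> ('j \<Rightarrow> 'j \<Rightarrow> 'j) \<Rightarrow> 'j \<Rightarrow> 'j \<Rightarrow> 'j"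
  where "quasi_inverse scale jprod y x =
    inv (bergman scale jprod x y) (x - Q_op scale jprod x y)"

lemma two_times_ring_half:
  assumes "(2::'k::comm_ring_1) dvd 1"
  shows "2 * (ring_half :: 'k) = 1"
proof -
  from assms obtain h :: 'k where h: "2 * h = 1"
    by (metis dvdE)
  have "k = h" if "2 * k = 1" for k :: 'k
  proof -
    have "k = (2 * h) * k" using h by simp
    also have "\<dots> = h * (2 * k)" by (simp only: ac_simps)
    finally show ?thesis using that by simp
  qed
  with h show ?thesis
    unfolding ring_half_def by (rule theI)
qed

lemma (in unital_jordan_algebra) Q_op_eq_U_op:
  assumes "(2::'k) dvd 1"
  shows "Q_op scale jprod x = U_op scale jprod x"
proof
  fix y
  have half: "ring_half * (2::'k) = 1"
    using two_times_ring_half[OF assms] by (simp add: mult.commute)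
  have two: "scale 2 z = z + z" for z
    using scale_left_distrib[of 1 1 z] by simp
  have "Q_op scale jprod x y =
      jprod (jprod x y) x + jprod x (jprod y x) - jprod y (jprod x x)"
    by (simp add: Q_op_def J_triple_def half)
  also have "\<dots> = U_op scale jprod x y"
    by (simp add: U_op_def L_op_def two jprod_commute[of "jprod x y" x]
        jprod_commute[of y x] jprod_commute[of y "jprod x x"])
  finally show "Q_op scale jprod x y = U_op scale jprod x y" .
qed

end

theory Submission
  imports Defs
begin

text \<open>
  Let \<open>[x, y, z] = (x \<bullet> y) \<bullet> z - x \<bullet> (y \<bullet> z)\<close> be the associator, which is antisymmetric in its
  outer arguments. The Jordan identity reads \<open>[x\<^sup>2, y, x] = 0\<close>, and after linearization it becomes
  the product rule \<open>[p \<bullet> q, y, r] = [p, y, q \<bullet> r] + [q, y, p \<bullet> r]\<close>. Applied to \<open>e = a \<bullet> b\<close> and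
  \<open>a = a\<^sup>2 \<bullet> b\<close>, where \<open>b = a\<^sup>-\<^sup>1\<close>, the product rule shows that \<open>L\<^sub>a\<close> and \<open>L\<^sub>b\<close> commute, and then
  that \<open>U\<^sub>a U\<^sub>b = id\<close> and \<open>[b, x, U\<^sub>a z] = - [a, x, z]\<close>. The last equation amounts to
  \<open>T(x, U\<^sub>a z, b) = T(x, a, z)\<close>, so expanding \<open>U\<^sub>x\<^sub>+\<^sub>b\<close> gives \<open>B(x, -a) = U\<^sub>x\<^sub>+\<^sub>b U\<^sub>a\<close>; this
  identifies the translated space. The product formula follows from the same factorization and
  \<open>U\<^sub>x\<^sub>+\<^sub>b a = U\<^sub>x a + 2x + b\<close>.
\<close>

context unital_jordan_algebra
begin

notation jprod (infixl "\<bullet>" 70)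

abbreviation "U \<equiv> U_op scale jprod"
abbreviation "T \<equiv> J_triple scale jprod"
abbreviation "B \<equiv> bergman scale jprod"
abbreviation "jinv \<equiv> J_inverse scale jprod"
abbreviation "units \<equiv> J_units scale jprod"

lemma jprod_add_left: "(x + y) \<bullet> z = x \<bullet> z + y \<bullet> z"
  by (metis jprod_add_right jprod_commute)

lemma jprod_zero_right: "x \<bullet> 0 = 0"
  using jprod_add_right[of x 0 0] by simp

lemma jprod_minus_right: "x \<bullet> (- y) = - (x \<bullet> y)"
  using jprod_add_right[of x y "- y"] by (simp add: jprod_zero_right minus_unique)

lemma jprod_minus_left: "(- x) \<bullet> y = - (x \<bullet> y)"
  by (metis jprod_minus_right jprod_commute)

lemma jprod_diff_right: "x \<bullet> (y - z) = x \<bullet> y - x \<bullet> z"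
  using jprod_add_right[of x y "- z"] by (simp add: jprod_minus_right)

lemmas jprod_distribs =
  jprod_add_right jprod_add_left jprod_diff_right jprod_minus_right jprod_minus_left

lemma unit_right: "x \<bullet> e = x"
  by (metis jprod_commute unit_left)

lemma scale_two: "scale 2 x = x + x"
  using scale_left_distrib[of 1 1 x] by simp

lemma U_apply: "U x z = scale 2 (x \<bullet> (x \<bullet> z)) - (x \<bullet> x) \<bullet> z"
  by (simp add: U_op_def L_op_def)

lemma module_hom_U: "module_hom scale scale (U x)"
  by (rule module_hom.intro[OF module_axioms module_axioms])
    (unfold_locales,
      simp_all add: U_apply jprod_add_right jprod_scale_right scale_right_distrib
        scale_right_diff_distrib mult.commute)

lemmas U_diff = module_hom.diff[OF module_hom_U]
lemmas U_scale = module_hom.scale[OF module_hom_U]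

lemma U_minus_left: "U (- x) = U x"
  by (rule ext) (simp add: U_apply jprod_distribs)

lemma U_unit_right: "U x e = x \<bullet> x"
  by (simp add: U_apply unit_right scale_two)

lemma U_jprod_self: "U x (x \<bullet> z) = x \<bullet> U x z"
  by (simp add: U_apply jprod_diff_right jprod_scale_right jordan_identity)

lemma units_iff_bij_U: "x \<in> units \<longleftrightarrow> bij (U x)"
  by (simp add: J_units_def module_GL_def module_hom_U)

lemma U_jinv: "x \<in> units \<Longrightarrow> U x (jinv x) = x"
  by (simp add: units_iff_bij_U J_inverse_def bij_is_surj surj_f_inv_f)

definition associator :: "'j \<Rightarrow> 'j \<Rightarrow> 'j \<Rightarrow> 'j"
  where "associator x y z = (x \<bullet> y) \<bullet> z - x \<bullet> (y \<bullet> z)"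

lemma associator_swap: "associator x y z = - associator z y x"
  by (simp add: associator_def jprod_commute)

lemma associator_unit_left: "associator e y z = 0"
  by (simp add: associator_def unit_left)

lemma associator_unit_right: "associator x y e = 0"
  by (simp add: associator_def unit_right)

lemma associator_add_left: "associator (x + x') y z = associator x y z + associator x' y z"
  by (simp add: associator_def jprod_distribs)

lemma associator_add_right: "associator x y (z + z') = associator x y z + associator x y z'"
  by (simp add: associator_def jprod_distribs)

lemma associator_diff_right: "associator x y (z - z') = associator x y z - associator x y z'"
  by (simp add: associator_def jprod_distribs)

lemma associator_scale_right: "associator x y (scale c z) = scale c (associator x y z)"
  by (simp add: associator_def jprod_scale_right scale_right_diff_distrib)

lemma associator_square_self: "associator (x \<bullet> x) y x = 0"
  using jordan_identity[of x y] by (simp add: associator_def jprod_commute)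

lemma triple_eq_associator: "T x y z = scale 2 (associator y x z + x \<bullet> (y \<bullet> z))"
  by (simp add: J_triple_def associator_def jprod_commute[of y x] algebra_simps)

lemma triple_minus_left: "T (- x) y z = - T x y z"
  by (simp add: J_triple_def jprod_distribs scale_two algebra_simps)

lemma triple_minus_middle: "T x (- y) z = - T x y z"
  by (simp add: J_triple_def jprod_distribs scale_two algebra_simps)

lemma U_add_left: "U (x + y) z = U x z + T x z y + U y z"
  by (simp add: U_apply J_triple_def scale_two jprod_distribs jprod_commute algebra_simps)

end

locale unital_jordan_algebra_half = unital_jordan_algebra scale jprod e
  for scale :: "'k::comm_ring_1 \<Rightarrow> 'j::ab_group_add \<Rightarrow> 'j"
    and jprod :: "'j \<Rightarrow> 'j \<Rightarrow> 'j" (infixl "\<bullet>" 70)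
    and e :: 'j +
  assumes two_dvd_one: "(2::'k) dvd 1"
begin

lemma scale_two_cancel:
  assumes "scale 2 x = scale 2 y"
  shows "x = y"
proof -
  have "ring_half * (2::'k) = 1"
    using two_times_ring_half[OF two_dvd_one] by (simp add: mult.commute)
  then show ?thesis
    using arg_cong[OF assms, of "scale ring_half"] by simp
qed

lemma bergman_apply: "B x y z = z - T x y z + U x (U y z)"
  by (simp add: bergman_def Q_op_eq_U_op[OF two_dvd_one])

lemma bergman_minus_left: "B (- x) y = B x (- y)"
  by (rule ext) (simp add: bergman_apply U_minus_left triple_minus_left triple_minus_middle)

lemma jordan_identity_linearized:
  "associator (p \<bullet> q) y r + associator (q \<bullet> r) y p + associator (r \<bullet> p) y q = 0"
    (is "?sum = 0")
proof (rule scale_two_cancel)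
  define F where "F x = associator (x \<bullet> x) y x" for x
  have "scale 2 ?sum = F (p + q + r) - F (p + q) - F (q + r) - F (r + p) + F p + F q + F r"
    by (simp add: F_def scale_two jprod_distribs associator_add_left associator_add_right
        jprod_commute[of q p] jprod_commute[of r q] jprod_commute[of p r])
  then show "scale 2 ?sum = scale 2 0"
    by (simp add: F_def associator_square_self)
qed

lemma associator_jprod_left:
  "associator (p \<bullet> q) y r = associator p y (q \<bullet> r) + associator q y (p \<bullet> r)"
  using jordan_identity_linearized[of p q y r]
  by (simp add: associator_swap[of _ _ p] associator_swap[of _ _ q] jprod_commute[of r p]
      algebra_simps)

definition inverse_pair :: "'j \<Rightarrow> 'j \<Rightarrow> bool"
  where "inverse_pair a b \<longleftrightarrow> a \<bullet> b = e \<and> (\<forall>z. a \<bullet> (b \<bullet> z) = b \<bullet> (a \<bullet> z))"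

lemma jprod_square_commute_inverse:
  assumes "a \<bullet> b = e"
  shows "(a \<bullet> a) \<bullet> (b \<bullet> z) = b \<bullet> ((a \<bullet> a) \<bullet> z)"
proof -
  have "associator (a \<bullet> a) z b = 0"
    by (simp add: associator_jprod_left assms associator_unit_right)
  then show ?thesis
    by (simp add: associator_def jprod_commute[of _ b] jprod_commute[of z b])
qed

lemma jprod_commute_inverse:
  assumes ab: "a \<bullet> b = e" and square: "(a \<bullet> a) \<bullet> b = a" and inj: "inj (U a)"
  shows "a \<bullet> (b \<bullet> z) = b \<bullet> (a \<bullet> z)"
proof -
  have ba: "b \<bullet> a = e" using ab by (simp add: jprod_commute)
  define D where "D w = a \<bullet> (b \<bullet> w) - b \<bullet> (a \<bullet> w)" for w
  have square_expanded: "scale 2 (a \<bullet> (b \<bullet> (a \<bullet> w))) = a \<bullet> w + (a \<bullet> a) \<bullet> (b \<bullet> w)" for w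
    using associator_jprod_left[of a a b w]
    by (simp add: associator_def scale_two ab square unit_left algebra_simps)
  have unit_expanded: "a \<bullet> (a \<bullet> (b \<bullet> w)) + b \<bullet> (a \<bullet> (a \<bullet> w)) = a \<bullet> w + (a \<bullet> a) \<bullet> (b \<bullet> w)" for w
    using associator_jprod_left[of a b a w]
    by (simp add: associator_def ab ba unit_left algebra_simps)
  have D_commute: "a \<bullet> D w = D (a \<bullet> w)" for w
    using square_expanded[of w] unit_expanded[of w]
    by (simp add: D_def scale_two jprod_diff_right algebra_simps)
  have "scale 2 (a \<bullet> (a \<bullet> D z)) = scale 2 (a \<bullet> D (a \<bullet> z))"
    by (simp only: D_commute)
  also have "\<dots> = a \<bullet> scale 2 (a \<bullet> (b \<bullet> (a \<bullet> z))) - scale 2 (a \<bullet> (b \<bullet> (a \<bullet> (a \<bullet> z))))"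
    by (simp add: D_def jprod_diff_right jprod_scale_right scale_right_diff_distrib)
  also have "\<dots> = (a \<bullet> a) \<bullet> D z"
    by (simp add: square_expanded D_def jprod_distribs jordan_identity)
  finally have "U a (D z) = U a 0"
    by (simp add: U_apply jprod_zero_right)
  then have "D z = 0" by (rule injD[OF inj])
  then show ?thesis by (simp add: D_def)
qed

lemma inverse_pairI:
  assumes inj: "inj (U a)" and "U a b = a"
  shows "inverse_pair a b"
proof -
  have "U a (a \<bullet> b) = U a e"
    by (simp add: U_jprod_self U_unit_right \<open>U a b = a\<close>)
  then have ab: "a \<bullet> b = e" by (rule injD[OF inj])
  moreover have "(a \<bullet> a) \<bullet> b = a"
    using \<open>U a b = a\<close> by (simp add: U_apply ab unit_right scale_two algebra_simps)
  ultimately show ?thesis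
    using jprod_commute_inverse[OF _ _ inj] by (simp add: inverse_pair_def)
qed

lemma inverse_pair_jinv: "a \<in> units \<Longrightarrow> inverse_pair a (jinv a)"
  by (rule inverse_pairI) (simp_all add: U_jinv units_iff_bij_U bij_is_inj)

lemma inverse_pair_sym: "inverse_pair a b \<Longrightarrow> inverse_pair b a"
  by (simp add: inverse_pair_def jprod_commute)

lemma inverse_pair_square_jprod:
  assumes "inverse_pair a b"
  shows "(a \<bullet> a) \<bullet> b = a"
proof -
  have "(a \<bullet> a) \<bullet> b = b \<bullet> (a \<bullet> a)" by (rule jprod_commute)
  also have "\<dots> = a \<bullet> (b \<bullet> a)" using assms by (simp add: inverse_pair_def)
  also have "\<dots> = a" using assms by (simp add: inverse_pair_def jprod_commute[of b] unit_right)
  finally show ?thesis .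
qed

context
  fixes a b
  assumes pair: "inverse_pair a b"
begin

lemma inverse_pair_jprod: "a \<bullet> b = e" "b \<bullet> a = e"
  using pair by (simp_all add: inverse_pair_def jprod_commute[of b])

lemma inverse_pair_commute: "a \<bullet> (b \<bullet> z) = b \<bullet> (a \<bullet> z)"
  using pair by (simp add: inverse_pair_def)

lemma U_inverse: "U a b = a"
  by (simp add: U_apply inverse_pair_jprod unit_right inverse_pair_square_jprod[OF pair] scale_two)

lemma U_jprod_inverse: "U a (b \<bullet> z) = a \<bullet> z"
  using associator_jprod_left[of a a b z]
  by (simp add: associator_def U_apply inverse_pair_square_jprod[OF pair] inverse_pair_jprod
      unit_left inverse_pair_commute scale_two algebra_simps)

lemma U_jprod_inverse_square: "U a ((b \<bullet> b) \<bullet> z) = scale 2 (a \<bullet> (b \<bullet> z)) - z"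
proof -
  have "(a \<bullet> a) \<bullet> (b \<bullet> b) = e"
    using jprod_square_commute_inverse[of a b b]
    by (simp add: inverse_pair_jprod inverse_pair_square_jprod[OF pair])
  moreover have "(b \<bullet> b) \<bullet> (a \<bullet> z) = a \<bullet> ((b \<bullet> b) \<bullet> z)"
    by (rule jprod_square_commute_inverse) (rule inverse_pair_jprod)
  ultimately show ?thesis
    using associator_jprod_left[of a a "b \<bullet> b" z]
    by (simp add: associator_def U_apply inverse_pair_jprod unit_left unit_right
        inverse_pair_commute scale_two algebra_simps)
qed

lemma U_U_inverse: "U a (U b z) = z"
proof -
  have "U a (U b z) = scale 2 (U a (b \<bullet> (b \<bullet> z))) - U a ((b \<bullet> b) \<bullet> z)"
    by (simp add: U_apply[of b] U_diff U_scale)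
  then show ?thesis
    by (simp add: U_jprod_inverse U_jprod_inverse_square)
qed

lemma associator_inverse_left: "associator a x (b \<bullet> z) = - associator b x (a \<bullet> z)"
  using associator_jprod_left[of a b x z]
  by (simp add: inverse_pair_jprod associator_unit_left eq_neg_iff_add_eq_0)

lemma associator_inverse_U: "associator b x (U a z) = - associator a x z"
proof -
  have "associator a x z
      = associator (a \<bullet> a) x (b \<bullet> z) + associator b x ((a \<bullet> a) \<bullet> z)"
    using associator_jprod_left[of "a \<bullet> a" b x z]
    by (simp add: inverse_pair_square_jprod[OF pair])
  also have "associator (a \<bullet> a) x (b \<bullet> z) = scale 2 (associator a x (b \<bullet> (a \<bullet> z)))"
    by (simp add: associator_jprod_left inverse_pair_commute scale_two)
  also have "\<dots> = - scale 2 (associator b x (a \<bullet> (a \<bullet> z)))"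
    by (simp add: associator_inverse_left)
  finally show ?thesis
    by (simp add: U_apply associator_diff_right associator_scale_right)
qed

lemma triple_inverse: "T x a b = scale 2 x"
proof -
  have "associator a x b = 0"
    using inverse_pair_commute[of x]
    by (simp add: associator_def jprod_commute[of _ b] jprod_commute[of x b])
  then show ?thesis
    by (simp add: triple_eq_associator inverse_pair_jprod unit_right)
qed

lemma jprod_inverse_U: "b \<bullet> U a z = a \<bullet> z"
proof -
  have "b \<bullet> U a z = U a (b \<bullet> z)"
    by (simp add: U_apply jprod_diff_right jprod_scale_right inverse_pair_commute
        jprod_square_commute_inverse[OF inverse_pair_jprod(1)])
  then show ?thesis
    by (simp add: U_jprod_inverse)
qed

lemma triple_U_inverse: "T x (U a z) b = T x a z"
proof -
  have "associator (U a z) x b = associator a x z"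
    by (simp add: associator_swap[of "U a z"] associator_inverse_U)
  moreover have "U a z \<bullet> b = a \<bullet> z"
    by (simp add: jprod_commute[of _ b] jprod_inverse_U)
  ultimately show ?thesis
    by (simp add: triple_eq_associator)
qed

end

context
  fixes a b
  assumes pair: "inverse_pair a b"
begin

lemma inverse_pair_in_units: "a \<in> units"
proof -
  have "U a \<circ> U b = id" "U b \<circ> U a = id"
    by (simp_all add: fun_eq_iff U_U_inverse[OF pair] U_U_inverse[OF inverse_pair_sym[OF pair]])
  then show ?thesis
    unfolding units_iff_bij_U by (metis o_bij)
qed

lemma bergman_factorization: "B x (- a) = U (x + b) \<circ> U a"
  by (rule ext)
    (simp add: bergman_apply triple_minus_middle U_minus_left U_add_left
      triple_U_inverse[OF pair] U_U_inverse[OF inverse_pair_sym[OF pair]])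

lemma bergman_in_module_GL_iff: "B x (- a) \<in> module_GL scale \<longleftrightarrow> x + b \<in> units"
proof -
  have "module_hom scale scale (B x (- a))"
    unfolding bergman_factorization by (rule module_hom_compose[OF module_hom_U module_hom_U])
  moreover have "bij (B x (- a)) \<longleftrightarrow> bij (U (x + b))"
    using inverse_pair_in_units
    by (metis units_iff_bij_U bergman_factorization bij_betw_comp_iff)
  ultimately show ?thesis
    by (simp add: module_GL_def units_iff_bij_U)
qed

lemma U_add_inverse: "U (x + b) a = U x a + scale 2 x + b"
  by (simp add: U_add_left triple_inverse[OF pair] U_inverse[OF inverse_pair_sym[OF pair]])

lemma quasi_inverse_eq:
  assumes "y + b \<in> units"
  shows "quasi_inverse scale jprod a (- y) = U b (jinv (y + b)) - b"
proof -
  have B: "B (- y) a = U (y + b) \<circ> U a"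
    by (simp add: bergman_minus_left bergman_factorization)
  have "inj (B (- y) a)"
    using bergman_in_module_GL_iff[of y] assms
    by (simp add: bergman_minus_left module_GL_def bij_is_inj)
  moreover have "B (- y) a (U b (jinv (y + b)) - b) = - y - Q_op scale jprod (- y) a"
    by (simp add: B U_diff U_U_inverse[OF pair] U_inverse[OF pair] U_jinv[OF assms]
        U_add_inverse Q_op_eq_U_op[OF two_dvd_one] U_minus_left scale_two)
  ultimately show ?thesis
    unfolding quasi_inverse_def by (rule inv_f_eq)
qed

lemma J_mu_translated:
  assumes "y + b \<in> units"
  shows "J_mu scale jprod (x + b) (y + b) - b
    = scale 2 x + U x a + B x (- a) (quasi_inverse scale jprod a (- y))"
proof -
  have "B x (- a) (quasi_inverse scale jprod a (- y))
      = J_mu scale jprod (x + b) (y + b) - U (x + b) a"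
    by (simp add: quasi_inverse_eq[OF assms] bergman_factorization J_mu_def U_diff
        U_U_inverse[OF pair] U_inverse[OF pair])
  then show ?thesis by (simp add: U_add_inverse)
qed

end

end

theorem proposition2p2:
  fixes scale :: "'k::comm_ring_1 \<Rightarrow> 'j::ab_group_add \<Rightarrow> 'j"
    and jprod :: "'j \<Rightarrow> 'j \<Rightarrow> 'j"
    and e a :: 'j
    and \<tau> :: "'j \<Rightarrow> 'j"
  assumes two_invertible: "(2::'k) dvd 1"
    and three_invertible: "(3::'k) dvd 1"
    and jordan: "unital_jordan_algebra scale jprod e"
    and a_unit: "a \<in> J_units scale jprod"
    and tau: "\<tau> = (\<lambda>x. x - J_inverse scale jprod a)"
  shows "\<tau> ` J_units scale jprod = {x. bergman scale jprod x (- a) \<in> module_GL scale}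
    \<and> (\<forall>x \<in> \<tau> ` J_units scale jprod. \<forall>y \<in> \<tau> ` J_units scale jprod.
          bergman scale jprod (- y) a \<in> module_GL scale
        \<and> \<tau> (J_mu scale jprod (inv \<tau> x) (inv \<tau> y))
            = scale 2 x + U_op scale jprod x a
              + bergman scale jprod x (- a) (quasi_inverse scale jprod a (- y)))"
proof -
  interpret unital_jordan_algebra_half scale jprod e
    using jordan two_invertible
    by (simp add: unital_jordan_algebra_half_def unital_jordan_algebra_half_axioms_def)
  define b where "b = jinv a"
  have pair: "inverse_pair a b"
    unfolding b_def using a_unit by (rule inverse_pair_jinv)
  have tau_b: "\<tau> = (\<lambda>x. x - b)" by (simp add: tau b_def)
  have inv_tau: "inv \<tau> x = x + b" for x
    by (rule inv_f_eq) (simp_all add: tau_b inj_def)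
  have image: "\<tau> ` units = {x. x + b \<in> units}"
    by (force simp: tau_b image_iff)
  show ?thesis
  proof (intro conjI ballI)
    show "\<tau> ` units = {x. B x (- a) \<in> module_GL scale}"
      by (simp add: image bergman_in_module_GL_iff[OF pair])
  next
    fix x y
    assume "y \<in> \<tau> ` units"
    then have y: "y + b \<in> units" by (simp add: image)
    then show "B (- y) a \<in> module_GL scale"
      by (simp add: bergman_minus_left bergman_in_module_GL_iff[OF pair])
    show "\<tau> (J_mu scale jprod (inv \<tau> x) (inv \<tau> y))
        = scale 2 x + U x a + B x (- a) (quasi_inverse scale jprod a (- y))"
      unfolding inv_tau using J_mu_translated[OF pair y] by (simp add: tau_b)
  qed
qed

end
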